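(* For each integer $L\ge 1$ let $P_L(1)$ denote the number of self-avoiding polygons crossing an $L\times L$ square (PCAS), and let $C_L(1)$ denote the number of self-avoiding walks crossing an $L\times L$ square (WCAS). Then PCAS have the same growth constant as WCAS; that is, the limit $\lim_{L\to\infty} P_L(1)^{1/L^2}$ exists and $$\lim_{L\to\infty} P_L(1)^{1/L^2}=\lambda:=\lim_{L\to\infty} C_L(1)^{1/L^2}.$$
   Context: The $L\times L$ square is the subgraph of the square lattice $\mathbb{Z}^2$ induced by the vertex set $\{0,1,\dots,L\}^2$ (so it has $(L+1)^2$ vertices and $L^2$ unit cells). A self-avoiding walk (SAW) is a sequence of distinct vertices, each being a nearest neighbour of its predecessor. A self-avoiding polygon (SAP) is a simple closed lattice path (a cycle in the lattice graph), obtained by adding the edge between the two end-points of a SAW whose end-points are nearest neighbours; it is regarded as unrooted and unoriented. A WCAS (walk crossing a square) is a SAW in the $L\times L$ square starting at the south-west corner $(0,0)$ and ending at the north-east corner $(L,L)$; $C_L(1)$ is the number of such walks (of any length). A PCAS (polygon crossing a square) is a SAP in the $L\times L$ square that passes through both diagonally opposite corners $(0,0)$ and $(L,L)$; $P_L(1)$ is the number of such polygons (of any length). It is a known result that the limit $\lambda=\lim_{L\to\infty}C_L(1)^{1/L^2}$ exists; $\lambda$ is called the growth constant of WCAS. The growth constant of another family counted by $a_L$ is $\lim_{L\to\infty}a_L^{1/L^2}$. *)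

theory Defs
  imports Complex_Main
begin

type_synonym vertex = "int \<times> int"

definition lattice_adj :: "vertex \<Rightarrow> vertex \<Rightarrow> bool" where
  "lattice_adj u v \<longleftrightarrow> \<bar>fst u - fst v\<bar> + \<bar>snd u - snd v\<bar> = 1"

definition is_saw :: "vertex list \<Rightarrow> bool" where
  "is_saw w \<longleftrightarrow> w \<noteq> [] \<and> distinct w \<and> successively lattice_adj w"

definition walk_edges :: "vertex list \<Rightarrow> vertex set set" where
  "walk_edges w = {{w ! i, w ! Suc i} | i. Suc i < length w}"

text \<open>
  A polygon is represented by its set of edges, each edge being the set of its two endpoints.
  So walks that trace the same cycle from different roots or in different directions give the
  same polygon. The bound on the length excludes the degenerate case of a single edge traversed
  back and forth, which is not a cycle.
\<close>
definition is_sap :: "vertex set set \<Rightarrow> bool" where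
  "is_sap E \<longleftrightarrow> (\<exists>w. is_saw w \<and> length w \<ge> 3 \<and> lattice_adj (last w) (hd w) \<and>
                  E = insert {last w, hd w} (walk_edges w))"

definition square :: "nat \<Rightarrow> vertex set" where
  "square L = {0..int L} \<times> {0..int L}"

definition wcas :: "nat \<Rightarrow> vertex list set" where
  "wcas L = {w. is_saw w \<and> set w \<subseteq> square L \<and> hd w = (0, 0) \<and> last w = (int L, int L)}"

definition pcas :: "nat \<Rightarrow> vertex set set set" where
  "pcas L = {E. is_sap E \<and> \<Union>E \<subseteq> square L \<and> (0, 0) \<in> \<Union>E \<and> (int L, int L) \<in> \<Union>E}"

lemma finite_wcas: "finite (wcas L)"
proof (rule finite_subset)
  show "wcas L \<subseteq> {w. set w \<subseteq> square L \<and> distinct w}"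
    by (auto simp: wcas_def is_saw_def)
  show "finite {w. set w \<subseteq> square L \<and> distinct w}"
    by (rule finite_subset_distinct) (simp add: square_def)
qed

lemma finite_pcas: "finite (pcas L)"
proof (rule finite_subset)
  show "pcas L \<subseteq> Pow (Pow (square L))"
    by (auto simp: pcas_def)
qed (simp add: square_def)

definition num_wcas :: "nat \<Rightarrow> nat" where
  "num_wcas L = card (wcas L)"

definition num_pcas :: "nat \<Rightarrow> nat" where
  "num_pcas L = card (pcas L)"

definition growth_seq :: "(nat \<Rightarrow> nat) \<Rightarrow> nat \<Rightarrow> real" where
  "growth_seq a L = real (a L) powr (1 / real (L ^ 2))"

text \<open>
  The value is meaningful only when \<open>growth_seq a\<close> converges.
\<close>
definition growth_constant :: "(nat \<Rightarrow> nat) \<Rightarrow> real" where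
  "growth_constant a = lim (growth_seq a)"

end

theory Submission imports Defs begin

text \<open>
  Write \<open>C\<^sub>L\<close> and \<open>P\<^sub>L\<close> for the numbers of walks and polygons crossing the square of side \<open>L\<close>.

  \<^emph>\<open>The limit for walks exists.\<close> Let \<open>c(n) = C\<^sub>n\<^sub>-\<^sub>1\<close> be the number of walks crossing an \<open>n \<times> n\<close>
  block of vertices. For odd \<open>k\<close>, a block of side \<open>k n\<close> is a \<open>k \<times> k\<close> array of blocks of side \<open>n\<close>.
  Arbitrary crossings of the small blocks, suitably reflected, can be chained along a snake that
  visits all of them, because the end corner of each crossing is a neighbour of the start corner
  of the next. Hence \<open>c(n)\<close> to the power \<open>k\<^sup>2\<close> is at most \<open>c(k n)\<close> (lemma
  \<open>crossings_square_power\<close>). Since \<open>c\<close> is also monotone and at most exponential in \<open>n\<^sup>2\<close>, a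
  Fekete-type argument shows that \<open>ln c(n) / n\<^sup>2\<close> tends to its supremum (lemma
  \<open>quadratic_superadditive_converges\<close>).

  \<^emph>\<open>Polygons are squeezed between walks.\<close> A polygon in the square that passes through the origin
  must use both edges of the square there; removing the edge from \<open>(0, 0)\<close> to \<open>(1, 0)\<close> turns it
  into a walk between these two vertices, and this is a bijection (lemma
  \<open>num_pcas_eq_card_corner_loops\<close>). Shift the square of side \<open>L\<close> up by one unit inside the square
  of side \<open>L + 1\<close>: what remains is the origin and the bottom row and right column from \<open>(1, 0)\<close> to
  \<open>(L + 1, L + 1)\<close>. Prefixing the origin and following this rim backwards closes any crossing walk
  to a polygon through both corners; following it forwards extends any opened polygon to a crossing
  walk. So \<open>C\<^sub>L \<le> P\<^sub>L\<^sub>+\<^sub>1\<close> and \<open>P\<^sub>L \<le> C\<^sub>L\<^sub>+\<^sub>1\<close>, and a bounded shift of \<open>L\<close> does not change the limit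
  (lemma \<open>growth_rate_shift\<close>).
\<close>

section \<open>Self-avoiding walks in a region\<close>

definition saws :: "vertex set \<Rightarrow> vertex \<Rightarrow> vertex \<Rightarrow> vertex list set" where
  "saws R u v = {w. is_saw w \<and> set w \<subseteq> R \<and> hd w = u \<and> last w = v}"

lemma lattice_adj_sym: "lattice_adj u v \<longleftrightarrow> lattice_adj v u"
  by (auto simp: lattice_adj_def abs_minus_commute)

lemma finite_saws: "finite R \<Longrightarrow> finite (saws R u v)"
  by (rule finite_subset[OF _ finite_subset_distinct[of R]]) (auto simp: saws_def is_saw_def)

lemma is_saw_append:
  assumes "is_saw xs" "is_saw ys" "set xs \<inter> set ys = {}" "lattice_adj (last xs) (hd ys)"
  shows "is_saw (xs @ ys)"
  using assms by (auto simp: is_saw_def successively_append_iff)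

lemma is_saw_rev: "is_saw w \<Longrightarrow> is_saw (rev w)"
  by (auto simp: is_saw_def successively_rev lattice_adj_sym)

lemma is_saw_map:
  assumes "is_saw w" "inj_on f (set w)"
    and "\<And>u v. lattice_adj u v \<Longrightarrow> lattice_adj (f u) (f v)"
  shows "is_saw (map f w)"
  using assms by (auto simp: is_saw_def distinct_map successively_map intro: successively_mono)

lemma saws_append:
  assumes "xs \<in> saws R u v" "ys \<in> saws R' u' v'" "R \<inter> R' = {}" "lattice_adj v u'"
  shows "xs @ ys \<in> saws (R \<union> R') u v'"
proof -
  have "is_saw (xs @ ys)"
    using assms by (intro is_saw_append) (auto simp: saws_def)
  moreover have "xs \<noteq> []" "ys \<noteq> []"
    using assms by (auto simp: saws_def is_saw_def)
  ultimately show ?thesis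
    using assms by (auto simp: saws_def)
qed

lemma saws_map:
  assumes "w \<in> saws R u v" "inj f" "\<And>u v. lattice_adj u v \<Longrightarrow> lattice_adj (f u) (f v)"
  shows "map f w \<in> saws (f ` R) (f u) (f v)"
proof -
  have "w \<noteq> []"
    using assms(1) by (auto simp: saws_def is_saw_def)
  then show ?thesis
    using assms by (auto simp: saws_def hd_map last_map intro!: is_saw_map intro: inj_on_subset)
qed

lemma saws_rev: "w \<in> saws R u v \<Longrightarrow> rev w \<in> saws R v u"
  by (auto simp: saws_def is_saw_rev hd_rev last_rev)

text \<open>
  The concatenation determines both pieces, since the first one consists of exactly those vertices
  that lie in the first region.
\<close>
lemma card_saws_glue:
  assumes "finite R" "finite R'" "R \<inter> R' = {}" "lattice_adj v u'"
  shows "card (saws R u v) * card (saws R' u' v') \<le> card (saws (R \<union> R') u v')"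
proof -
  have "inj_on (\<lambda>(xs, ys). xs @ ys) (saws R u v \<times> saws R' u' v')"
  proof (rule inj_onI, clarify)
    fix xs ys xs' ys'
    assume *: "xs \<in> saws R u v" "ys \<in> saws R' u' v'" "xs' \<in> saws R u v" "ys' \<in> saws R' u' v'"
      and eq: "xs @ ys = xs' @ ys'"
    have split: "filter (\<lambda>z. z \<in> R) (as @ bs) = as"
      if "as \<in> saws R u v" "bs \<in> saws R' u' v'" for as bs
    proof -
      have "filter (\<lambda>z. z \<in> R) as = as" "filter (\<lambda>z. z \<in> R) bs = []"
        using that assms(3) by (auto simp: saws_def filter_id_conv filter_empty_conv)
      then show ?thesis by simp
    qed
    have "xs = xs'"
      using split[of xs ys] split[of xs' ys'] * eq by metis
    then show "xs = xs' \<and> ys = ys'"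
      using eq by simp
  qed
  then have "card (saws R u v \<times> saws R' u' v') \<le> card (saws (R \<union> R') u v')"
    by (rule card_inj_on_le) (use assms in \<open>auto intro: saws_append finite_saws\<close>)
  then show ?thesis
    by (simp add: card_cartesian_product)
qed

lemma card_saws_image:
  assumes "finite R" "inj f" "\<And>u v. lattice_adj u v \<Longrightarrow> lattice_adj (f u) (f v)"
  shows "card (saws R u v) \<le> card (saws (f ` R) (f u) (f v))"
proof (rule card_inj_on_le)
  show "inj_on (map f) (saws R u v)"
    using assms(2) by (auto simp: inj_on_def)
  show "map f ` saws R u v \<subseteq> saws (f ` R) (f u) (f v)"
    using assms saws_map by blast
  show "finite (saws (f ` R) (f u) (f v))"
    using assms(1) by (simp add: finite_saws)
qed

text \<open>
  Induction on the region: after deleting the start vertex, the rest of the walk starts at one of its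
  four neighbours. The base \<open>5\<close> rather than \<open>4\<close> absorbs the walk that stops at once.
\<close>
lemma card_saws_le: "finite R \<Longrightarrow> card (saws R u v) \<le> 5 ^ card R"
proof (induction "card R" arbitrary: R u)
  case 0
  then have "saws R u v = {}"
    by (auto simp: saws_def is_saw_def)
  then show ?case by simp
next
  case (Suc n)
  let ?nbrs = "{(fst u + 1, snd u), (fst u - 1, snd u), (fst u, snd u + 1), (fst u, snd u - 1)}"
  show ?case
  proof (cases "u \<in> R")
    case False
    then have "saws R u v = {}"
      using hd_in_set by (fastforce simp: saws_def is_saw_def)
    then show ?thesis by simp
  next
    case True
    let ?U = "\<Union>z\<in>?nbrs. (#) u ` saws (R - {u}) z v"
    have cR: "card (R - {u}) = n"
      using Suc True by simp
    have sub: "saws R u v \<subseteq> insert [u] ?U"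
    proof
      fix w assume w: "w \<in> saws R u v"
      then obtain ws where ws: "w = u # ws"
        by (cases w) (auto simp: saws_def is_saw_def)
      show "w \<in> insert [u] ?U"
      proof (cases "ws = []")
        case False
        then have "lattice_adj u (hd ws)"
          using w ws by (auto simp: saws_def is_saw_def successively_Cons)
        then have "hd ws \<in> ?nbrs"
          by (cases u; cases "hd ws") (auto simp: lattice_adj_def abs_if split: if_splits)
        moreover have "ws \<in> saws (R - {u}) (hd ws) v"
          using w ws False by (auto simp: saws_def is_saw_def successively_Cons)
        ultimately show ?thesis
          using ws by blast
      qed (use ws in simp)
    qed
    have card_ext: "card ((#) u ` saws (R - {u}) z v) \<le> 5 ^ n" for z
    proof -
      have "card ((#) u ` saws (R - {u}) z v) \<le> card (saws (R - {u}) z v)"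
        using Suc.prems by (intro card_image_le finite_saws) simp
      also have "\<dots> \<le> 5 ^ n"
        using Suc.hyps(1)[of "R - {u}" z] cR Suc.prems by simp
      finally show ?thesis .
    qed
    have "card (saws R u v) \<le> card (insert [u] ?U)"
      using Suc.prems by (intro card_mono sub) (auto intro!: finite_saws)
    also have "\<dots> \<le> Suc (card ?U)"
      by (rule card_insert_le_m1) auto
    also have "card ?U \<le> (\<Sum>z\<in>?nbrs. card ((#) u ` saws (R - {u}) z v))"
      by (rule card_UN_le) simp
    also have "\<dots> \<le> card ?nbrs * 5 ^ n"
      using sum_bounded_above[of ?nbrs "\<lambda>z. card ((#) u ` saws (R - {u}) z v)" "5 ^ n"] card_ext
      by simp
    also have "\<dots> \<le> 4 * 5 ^ n"
      by (intro mult_right_mono card_insert_le_m1) auto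
    also have "Suc (4 * 5 ^ n) \<le> 5 ^ Suc n"
      by simp
    finally show ?thesis
      using Suc.hyps(2) by simp
  qed
qed

section \<open>Crossings of rectangles\<close>

text \<open>
  Rectangles are measured by their numbers of vertices per side, not by their side lengths, so that
  sizes simply add when rectangles are placed side by side.
\<close>
definition box :: "nat \<Rightarrow> nat \<Rightarrow> vertex set" where
  "box m n = {0..<int m} \<times> {0..<int n}"

definition crossings :: "nat \<Rightarrow> nat \<Rightarrow> nat" where
  "crossings m n = card (saws (box m n) (0, 0) (int m - 1, int n - 1))"

lemma finite_box [simp]: "finite (box m n)"
  by (simp add: box_def)

lemma num_wcas_eq_crossings: "num_wcas L = crossings (Suc L) (Suc L)"
proof -
  have "square L = box (Suc L) (Suc L)"
    by (auto simp: square_def box_def)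
  then show ?thesis
    by (simp add: num_wcas_def crossings_def wcas_def saws_def)
qed

lemma crossings_transpose: "crossings m n \<le> crossings n m"
proof -
  have "prod.swap ` box m n = box n m"
    by (auto simp: box_def image_iff)
  moreover have "lattice_adj (prod.swap u) (prod.swap v)" if "lattice_adj u v" for u v
    using that by (simp add: lattice_adj_def)
  ultimately show ?thesis
    using card_saws_image[of "box m n" prod.swap "(0, 0)" "(int m - 1, int n - 1)"]
    by (simp add: crossings_def)
qed

text \<open>
  Three rectangles side by side: the first walk ends at the top right, so the middle rectangle is
  flipped vertically to be entered at its top left corner and left at the bottom right; the third is
  then entered at the bottom left again. This return to the original orientation is why an odd number
  of rectangles is needed.
\<close>
lemma crossings_glue3:
  assumes "m > 0" "m' > 0" "m'' > 0" "n > 0"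
  shows "crossings m n * crossings m' n * crossings m'' n \<le> crossings (m + m' + m'') n"
proof -
  define f :: "vertex \<Rightarrow> vertex" where "f = (\<lambda>(x, y). (x + int m, int n - 1 - y))"
  define g :: "vertex \<Rightarrow> vertex" where "g = (\<lambda>(x, y). (x + int m + int m', y))"
  have f: "inj f" "\<And>u v. lattice_adj u v \<Longrightarrow> lattice_adj (f u) (f v)"
    by (auto simp: f_def inj_def lattice_adj_def abs_minus_commute)
  have g: "inj g" "\<And>u v. lattice_adj u v \<Longrightarrow> lattice_adj (g u) (g v)"
    by (auto simp: g_def inj_def lattice_adj_def)
  have fbox: "f ` box m' n = {int m..<int m + int m'} \<times> {0..<int n}"
  proof (intro equalityI subsetI)
    fix z assume "z \<in> {int m..<int m + int m'} \<times> {0..<int n}"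
    then have "z = f (fst z - int m, int n - 1 - snd z)" "(fst z - int m, int n - 1 - snd z) \<in> box m' n"
      by (auto simp: f_def box_def)
    then show "z \<in> f ` box m' n" by (rule image_eqI)
  qed (auto simp: f_def box_def)
  have gbox: "g ` box m'' n = {int m + int m'..<int m + int m' + int m''} \<times> {0..<int n}"
  proof (intro equalityI subsetI)
    fix z assume "z \<in> {int m + int m'..<int m + int m' + int m''} \<times> {0..<int n}"
    then have "z = g (fst z - int m - int m', snd z)" "(fst z - int m - int m', snd z) \<in> box m'' n"
      by (auto simp: g_def box_def)
    then show "z \<in> g ` box m'' n" by (rule image_eqI)
  qed (auto simp: g_def box_def)
  have union: "box m n \<union> f ` box m' n \<union> g ` box m'' n = box (m + m' + m'') n"
    unfolding fbox gbox by (auto simp: box_def)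
  let ?A = "saws (box m n) (0, 0) (int m - 1, int n - 1)"
  let ?B = "saws (f ` box m' n) (f (0, 0)) (f (int m' - 1, int n - 1))"
  let ?C = "saws (g ` box m'' n) (g (0, 0)) (g (int m'' - 1, int n - 1))"
  have "crossings m n * crossings m' n * crossings m'' n \<le> card ?A * card ?B * card ?C"
    unfolding crossings_def
    by (intro mult_le_mono card_saws_image f g le_refl finite_box)
  also have "card ?A * card ?B \<le> card (saws (box m n \<union> f ` box m' n) (0, 0) (f (int m' - 1, int n - 1)))"
    by (rule card_saws_glue) (use fbox in \<open>auto simp: f_def lattice_adj_def box_def\<close>)
  also have "card (saws (box m n \<union> f ` box m' n) (0, 0) (f (int m' - 1, int n - 1))) * card ?C
      \<le> card (saws (box m n \<union> f ` box m' n \<union> g ` box m'' n) (0, 0) (g (int m'' - 1, int n - 1)))"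
    by (rule card_saws_glue) (use fbox gbox in \<open>auto simp: f_def g_def lattice_adj_def box_def\<close>)
  also have "\<dots> = crossings (m + m' + m'') n"
    unfolding union by (simp add: crossings_def g_def algebra_simps)
  finally show ?thesis by simp
qed

lemma crossings_row:
  assumes "m > 0" "n > 0" "odd k"
  shows "crossings m n ^ k \<le> crossings (k * m) n"
proof -
  have "crossings m n ^ (2 * j + 1) \<le> crossings ((2 * j + 1) * m) n" for j
  proof (induction j)
    case (Suc j)
    have "crossings m n ^ (2 * Suc j + 1) = crossings m n ^ (2 * j + 1) * crossings m n * crossings m n"
      by simp
    also have "\<dots> \<le> crossings ((2 * j + 1) * m) n * crossings m n * crossings m n"
      using Suc by (intro mult_right_mono) auto
    also have "\<dots> \<le> crossings ((2 * j + 1) * m + m + m) n"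
      using assms by (intro crossings_glue3) auto
    finally show ?case by (simp add: algebra_simps)
  qed simp
  then show ?thesis
    using assms(3) by (metis oddE)
qed

text \<open>
  The snake through a \<open>k \<times> k\<close> array is assembled in two rounds: \<open>k\<close> blocks form a row, and by
  transposition \<open>k\<close> rows are stacked in the same way.
\<close>
lemma crossings_square_power:
  assumes "n > 0" "odd k"
  shows "crossings n n ^ (k ^ 2) \<le> crossings (k * n) (k * n)"
proof -
  have "k > 0"
    using assms(2) odd_pos by blast
  have "crossings n n ^ (k ^ 2) = (crossings n n ^ k) ^ k"
    by (simp add: power_mult power2_eq_square)
  also have "\<dots> \<le> crossings (k * n) n ^ k"
    using assms by (intro power_mono crossings_row) auto
  also have "\<dots> \<le> crossings n (k * n) ^ k"
    by (intro power_mono crossings_transpose) auto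
  also have "\<dots> \<le> crossings (k * n) (k * n)"
    using assms \<open>k > 0\<close> by (intro crossings_row) auto
  finally show ?thesis .
qed

lemma crossings_square_Suc:
  assumes "n > 0"
  shows "crossings n n \<le> crossings (Suc n) (Suc n)"
proof -
  let ?s = "[(int n, int n - 1), (int n, int n)]"
  have s: "?s \<in> saws (set ?s) (int n, int n - 1) (int n, int n)"
    by (auto simp: saws_def is_saw_def lattice_adj_def)
  show ?thesis
    unfolding crossings_def
  proof (rule card_inj_on_le)
    show "inj_on (\<lambda>w. w @ ?s) (saws (box n n) (0, 0) (int n - 1, int n - 1))"
      by (simp add: inj_on_def)
    show "finite (saws (box (Suc n) (Suc n)) (0, 0) (int (Suc n) - 1, int (Suc n) - 1))"
      by (simp add: finite_saws)
    show "(\<lambda>w. w @ ?s) ` saws (box n n) (0, 0) (int n - 1, int n - 1)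
        \<subseteq> saws (box (Suc n) (Suc n)) (0, 0) (int (Suc n) - 1, int (Suc n) - 1)"
    proof (rule image_subsetI)
      fix w assume w: "w \<in> saws (box n n) (0, 0) (int n - 1, int n - 1)"
      have "w @ ?s \<in> saws (box n n \<union> set ?s) (0, 0) (int n, int n)"
        by (rule saws_append[OF w s]) (auto simp: box_def lattice_adj_def)
      moreover have "box n n \<union> set ?s \<subseteq> box (Suc n) (Suc n)"
        using assms by (auto simp: box_def)
      ultimately show "w @ ?s \<in> saws (box (Suc n) (Suc n)) (0, 0) (int (Suc n) - 1, int (Suc n) - 1)"
        by (auto simp: saws_def)
    qed
  qed
qed

lemma crossings_square_mono:
  assumes "0 < m" "m \<le> n"
  shows "crossings m m \<le> crossings n n"
  using assms(2,1) by (induction rule: dec_induct) (auto intro: order_trans[OF _ crossings_square_Suc])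

lemma crossings_square_pos: "n > 0 \<Longrightarrow> crossings n n > 0"
proof -
  assume "n > 0"
  have "[(0, 0)] \<in> saws (box 1 1) (0, 0) (int 1 - 1, int 1 - 1)"
    by (auto simp: saws_def is_saw_def box_def)
  then have "crossings 1 1 > 0"
    unfolding crossings_def by (auto simp: card_gt_0_iff finite_saws)
  then show ?thesis
    using crossings_square_mono[of 1 n] \<open>n > 0\<close> by simp
qed

lemma crossings_square_le: "crossings n n \<le> 5 ^ (n ^ 2)"
  using card_saws_le[of "box n n"] by (simp add: crossings_def box_def power2_eq_square)

section \<open>Existence of the growth rate\<close>

text \<open>
  The multiples \<open>k n\<close> with \<open>k\<close> odd have gaps of length \<open>2 n\<close>, so each large \<open>N\<close> lies within \<open>2 n\<close>
  above one of them. By monotonicity \<open>x N / N\<^sup>2\<close> is then at least \<open>x n / n\<^sup>2\<close> up to a factor that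
  tends to \<open>1\<close>, and the limit is the supremum.
\<close>
lemma quadratic_superadditive_converges:
  fixes x :: "nat \<Rightarrow> real"
  assumes bounded: "\<And>n. n > 0 \<Longrightarrow> x n \<le> real n ^ 2 * B"
    and nonneg: "\<And>n. n > 0 \<Longrightarrow> 0 \<le> x n"
    and mono: "\<And>m n. 0 < m \<Longrightarrow> m \<le> n \<Longrightarrow> x m \<le> x n"
    and super: "\<And>k n. n > 0 \<Longrightarrow> odd k \<Longrightarrow> real k ^ 2 * x n \<le> x (k * n)"
  shows "convergent (\<lambda>n. x n / real n ^ 2)"
proof -
  define y where "y n = x n / real n ^ 2" for n
  define l where "l = (SUP n\<in>{0<..}. y n)"
  have "y n \<le> B" if "n > 0" for n
    using bounded[OF that] that by (simp add: y_def divide_le_eq mult.commute)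
  then have bdd: "bdd_above (y ` {0<..})"
    by (auto intro!: bdd_aboveI)
  have upper: "y n \<le> l" if "n > 0" for n
    unfolding l_def using that by (intro cSUP_upper bdd) auto
  have lower: "y n * ((real N - 2 * real n) / real N) ^ 2 \<le> y N" if n: "n > 0" and N: "N \<ge> 2 * n" for n N
  proof -
    define q where "q = (N - n) div (2 * n)"
    \<comment> \<open>this is the largest odd \<open>k\<close> with \<open>k * n \<le> N\<close>\<close>
    define k where "k = 2 * q + 1"
    have "2 * n * q \<le> N - n" "N - n < 2 * n * q + 2 * n"
      using n by (auto simp: q_def intro: dividend_less_times_div)
        (metis dividend_less_times_div add.commute mult_Suc_right mult_pos_pos zero_less_numeral)
    then have k: "k * n \<le> N" "N < k * n + 2 * n" and "odd k"
      using N by (auto simp: k_def algebra_simps)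
    have pos: "k * n > 0"
      using n by (simp add: k_def)
    have "real N < real (k * n + 2 * n)"
      using k(2) by (simp only: of_nat_less_iff)
    then have "(real N - 2 * real n) ^ 2 \<le> (real k * real n) ^ 2"
      using N by (intro power_mono) (auto simp flip: of_nat_mult)
    then have "y n * (real N - 2 * real n) ^ 2 \<le> y n * (real k * real n) ^ 2"
      using nonneg[OF n] by (intro mult_left_mono) (auto simp: y_def)
    also have "\<dots> = real k ^ 2 * x n"
      using n by (simp add: y_def power_mult_distrib)
    also have "\<dots> \<le> x N"
      using super[OF n \<open>odd k\<close>] mono[OF pos k(1)] by simp
    finally have "y n * (real N - 2 * real n) ^ 2 / real N ^ 2 \<le> x N / real N ^ 2"
      by (rule divide_right_mono) simp
    then show ?thesis
      by (simp add: y_def power_divide)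
  qed
  have "y \<longlonglongrightarrow> l"
  proof (rule order_tendstoI)
    fix a assume "l < a"
    then show "\<forall>\<^sub>F N in sequentially. y N < a"
      using upper by (intro eventually_sequentiallyI[of 1]) (meson le_less_trans less_le_trans zero_less_one)
  next
    fix a assume "a < l"
    then obtain n where n: "n > 0" "a < y n"
      unfolding l_def using less_cSUP_iff[OF _ bdd] by auto
    have "(\<lambda>N. y n * (1 - 2 * real n * inverse (real N)) ^ 2) \<longlonglongrightarrow> y n * (1 - 2 * real n * 0) ^ 2"
      by (intro tendsto_intros lim_inverse_n)
    then have "\<forall>\<^sub>F N in sequentially. a < y n * (1 - 2 * real n * inverse (real N)) ^ 2"
      using n by (intro order_tendstoD(1)) auto
    then show "\<forall>\<^sub>F N in sequentially. a < y N"
      using eventually_ge_at_top[of "2 * n"]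
    proof eventually_elim
      case (elim N)
      have "1 - 2 * real n * inverse (real N) = (real N - 2 * real n) / real N"
        using elim(2) n(1) by (simp add: field_simps)
      then show ?case
        using elim lower[OF n(1) elim(2)] by simp
    qed
  qed
  then show ?thesis
    unfolding y_def by (auto simp: convergent_def)
qed

lemma crossings_growth_converges:
  "convergent (\<lambda>n. ln (real (crossings n n)) / real n ^ 2)"
proof (rule quadratic_superadditive_converges)
  fix n :: nat assume n: "n > 0"
  have "ln (real (crossings n n)) \<le> ln (real (5 ^ (n ^ 2)))"
    using crossings_square_le[of n] crossings_square_pos[OF n] by (subst ln_le_cancel_iff) (auto simp del: of_nat_power)
  then show "ln (real (crossings n n)) \<le> real n ^ 2 * ln 5"
    by (simp add: ln_realpow)
  show "0 \<le> ln (real (crossings n n))"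
    using crossings_square_pos[OF n] by simp
next
  fix m n :: nat assume "0 < m" "m \<le> n"
  then show "ln (real (crossings m m)) \<le> ln (real (crossings n n))"
    using crossings_square_mono[of m n] crossings_square_pos[of m] by simp
next
  fix k n :: nat assume n: "n > 0" and k: "odd k"
  have "ln (real (crossings n n ^ (k ^ 2))) \<le> ln (real (crossings (k * n) (k * n)))"
    using crossings_square_power[OF n k] crossings_square_pos[OF n] crossings_square_pos[of "k * n"] n
      odd_pos[OF k]
    by (subst ln_le_cancel_iff) (simp_all del: of_nat_power)
  then show "real k ^ 2 * ln (real (crossings n n)) \<le> ln (real (crossings (k * n) (k * n)))"
    using crossings_square_pos[OF n] by (simp add: ln_realpow)
qed


section \<open>Polygons as closed walks\<close>

text \<open>
  For a walk of at least three vertices with adjacent ends this is the polygon that it traces.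
\<close>
definition closing :: "vertex list \<Rightarrow> vertex set set" where
  "closing w = insert {last w, hd w} (walk_edges w)"

lemma walk_edges_simps [simp]:
  "walk_edges [] = {}"
  "walk_edges [x] = {}"
  "walk_edges (x # y # zs) = insert {x, y} (walk_edges (y # zs))"
proof -
  show "walk_edges (x # y # zs) = insert {x, y} (walk_edges (y # zs))"
  proof (intro equalityI subsetI)
    fix e assume "e \<in> walk_edges (x # y # zs)"
    then obtain i where i: "e = {(x # y # zs) ! i, (x # y # zs) ! Suc i}" "Suc i < length (x # y # zs)"
      by (auto simp: walk_edges_def)
    then show "e \<in> insert {x, y} (walk_edges (y # zs))"
      by (cases i) (auto simp: walk_edges_def)
  next
    fix e assume "e \<in> insert {x, y} (walk_edges (y # zs))"
    then consider "e = {x, y}"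
      | i where "e = {(y # zs) ! i, (y # zs) ! Suc i}" "Suc i < length (y # zs)"
      by (auto simp: walk_edges_def)
    then show "e \<in> walk_edges (x # y # zs)"
    proof cases
      case 1
      then show ?thesis
        unfolding walk_edges_def by (auto intro!: exI[of _ 0])
    next
      case (2 i)
      then show ?thesis
        unfolding walk_edges_def by (auto intro!: exI[of _ "Suc i"])
    qed
  qed
qed (auto simp: walk_edges_def)

lemma walk_edges_append:
  assumes "xs \<noteq> []" "ys \<noteq> []"
  shows "walk_edges (xs @ ys) = insert {last xs, hd ys} (walk_edges xs \<union> walk_edges ys)"
  using assms(1)
proof (induction xs rule: induct_list012)
  case (2 x)
  then show ?case
    using assms(2) by (cases ys) auto
qed auto

lemma walk_edges_rev: "walk_edges (rev w) = walk_edges w"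
proof (induction w rule: induct_list012)
  case (3 x y zs)
  then show ?case
    using walk_edges_append[of "rev (y # zs)" "[x]"] by (auto simp: insert_commute)
qed auto

lemma Union_walk_edges: "length w \<ge> 2 \<Longrightarrow> \<Union>(walk_edges w) = set w"
proof (induction w rule: induct_list012)
  case (3 x y zs)
  then show ?case
    by (cases zs) auto
qed auto

lemma Union_walk_edges_subset: "\<Union>(walk_edges w) \<subseteq> set w"
  using Union_walk_edges[of w] by (induction w rule: induct_list012) auto

lemma closing_rotate: "closing (xs @ ys) = closing (ys @ xs)"
  by (cases "xs = [] \<or> ys = []") (auto simp: closing_def walk_edges_append)

lemma closing_rev: "closing (rev w) = closing w"
  by (cases "w = []") (auto simp: closing_def walk_edges_rev hd_rev last_rev insert_commute)

lemma Union_closing: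
  assumes "w \<noteq> []"
  shows "\<Union>(closing w) = set w"
proof (cases "length w \<ge> 2")
  case True
  then show ?thesis
    using assms Union_walk_edges[OF True] by (auto simp: closing_def)
next
  case False
  with assms obtain x where "w = [x]"
    by (cases w rule: remdups_adj.cases) auto
  then show ?thesis
    by (simp add: closing_def)
qed

text \<open>
  The start vertex lies on a single edge of the walk, which reveals the second vertex; removing that
  edge leaves the edge set of the remaining walk.
\<close>
lemma walk_edges_inject:
  assumes "distinct w" "distinct w'" "w \<noteq> []" "w' \<noteq> []" "hd w = hd w'" "walk_edges w = walk_edges w'"
  shows "w = w'"
  using assms
proof (induction w arbitrary: w' rule: induct_list012)
  case (2 x)
  then show ?case
    by (cases w' rule: remdups_adj.cases) auto
next
  case (3 x y zs)
  then obtain y' zs' where w': "w' = x # y' # zs'"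
    by (cases w' rule: remdups_adj.cases) auto
  have fresh: "e \<notin> walk_edges (y # zs)" "e \<notin> walk_edges (y' # zs')" if "x \<in> e" for e
    using that "3.prems"(1,2) w' Union_walk_edges_subset[of "y # zs"] Union_walk_edges_subset[of "y' # zs'"]
    by auto
  have eq: "insert {x, y} (walk_edges (y # zs)) = insert {x, y'} (walk_edges (y' # zs'))"
    using "3.prems"(6) w' by simp
  then have "{x, y} = {x, y'}"
    using fresh(2)[of "{x, y}"] by auto
  then have y: "y = y'"
    by (auto simp: doubleton_eq_iff)
  with eq fresh[of "{x, y}"] have "walk_edges (y # zs) = walk_edges (y' # zs')"
    by (metis insertCI insert_ident)
  then have "y # zs = y' # zs'"
    using "3.prems" w' y by (intro "3.IH"(2)) auto
  then show ?case
    using w' by simp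
qed auto

lemma closing_edge_notin_walk_edges:
  assumes "distinct w" "length w \<ge> 3"
  shows "{last w, hd w} \<notin> walk_edges w"
proof -
  obtain x y zs where w: "w = x # y # zs" "zs \<noteq> []"
    using assms(2) by (cases w rule: remdups_adj.cases) (auto simp: Suc_le_eq)
  have "{last zs, x} \<noteq> {x, y}"
    using assms(1) w by (auto simp: doubleton_eq_iff)
  moreover have "{last zs, x} \<notin> walk_edges (y # zs)"
    using assms(1) w Union_walk_edges_subset[of "y # zs"] by auto
  ultimately show ?thesis
    using w by simp
qed

text \<open>
  The closing edge is known from the end points and is not an edge of the walk, so it can be removed
  from the polygon.
\<close>
lemma closing_inject:
  assumes "distinct w" "distinct w'" "length w \<ge> 3" "length w' \<ge> 3"
    and "hd w = hd w'" "last w = last w'" "closing w = closing w'"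
  shows "w = w'"
proof (rule walk_edges_inject)
  show "walk_edges w = walk_edges w'"
    using assms closing_edge_notin_walk_edges[of w] closing_edge_notin_walk_edges[of w']
    by (metis closing_def insert_ident)
qed (use assms in auto)

text \<open>
  Polygons crossing the square, cut open at the edge from \<open>(0, 0)\<close> to \<open>(1, 0)\<close>: fixing root and
  orientation in this way gives each polygon a unique representing walk.
\<close>
definition corner_loops :: "nat \<Rightarrow> vertex list set" where
  "corner_loops L = {w \<in> saws (square L) (0, 0) (1, 0). (int L, int L) \<in> set w}"

lemma finite_corner_loops: "finite (corner_loops L)"
  by (simp add: corner_loops_def finite_saws square_def)

lemma length_corner_loop:
  assumes "w \<in> corner_loops L" "L > 0"
  shows "length w \<ge> 3"
proof -
  have w: "w \<noteq> []" "hd w = (0, 0)" "last w = (1, 0)" "(int L, int L) \<in> set w"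
    using assms(1) by (auto simp: corner_loops_def saws_def is_saw_def)
  have "{(0, 0), (1, 0), (int L, int L)} \<subseteq> set w"
    using w(4) hd_in_set[OF w(1)] last_in_set[OF w(1)] by (simp add: w(2,3))
  then have "card {(0 :: int, 0 :: int), (1, 0), (int L, int L)} \<le> card (set w)"
    by (rule card_mono[rotated]) simp
  then show ?thesis
    using assms(2) card_length[of w] by simp
qed

lemma closing_rotate_to_vertex:
  assumes "is_saw w" "lattice_adj (last w) (hd w)" "p \<in> set w"
  obtains w' where "is_saw w'" "lattice_adj (last w') (hd w')" "hd w' = p"
    "closing w' = closing w" "length w' = length w"
proof -
  obtain xs zs where w: "w = xs @ p # zs"
    using assms(3) by (auto simp: in_set_conv_decomp)
  have "is_saw (p # zs @ xs)" "lattice_adj (last (p # zs @ xs)) p"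
    using assms(1,2)
    by (cases "xs = []"; cases "zs = []";
        force simp: w is_saw_def successively_append_iff successively_Cons)+
  moreover have "closing (p # zs @ xs) = closing w"
    using closing_rotate[of xs "p # zs"] by (simp add: w)
  ultimately show ?thesis
    using that[of "p # zs @ xs"] by (simp add: w)
qed

text \<open>
  Every polygon in question arises: root it at the origin. Its two neighbours there are distinct
  vertices of the square, hence \<open>(1, 0)\<close> and \<open>(0, 1)\<close> in some order, and reversing the direction
  if necessary makes \<open>(1, 0)\<close> the last vertex.
\<close>
lemma closing_image_corner_loops:
  assumes "L > 0"
  shows "closing ` corner_loops L = pcas L"
proof (intro equalityI subsetI)
  fix E assume "E \<in> closing ` corner_loops L"
  then obtain w where w: "w \<in> corner_loops L" "E = closing w"
    by blast
  then have saw: "is_saw w" "set w \<subseteq> square L" "hd w = (0, 0)" "last w = (1, 0)"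
    "(int L, int L) \<in> set w" "w \<noteq> []"
    by (auto simp: corner_loops_def saws_def is_saw_def)
  have "is_sap E"
    unfolding is_sap_def
    using saw length_corner_loop[OF w(1) assms] w(2)
    by (intro exI[of _ w]) (simp add: closing_def lattice_adj_def)
  moreover have "\<Union>E = set w"
    using w(2) Union_closing[OF saw(6)] by simp
  ultimately show "E \<in> pcas L"
    using saw hd_in_set[OF saw(6)] by (simp add: pcas_def del: Union_iff)
next
  fix E assume E: "E \<in> pcas L"
  then obtain v where v: "is_saw v" "length v \<ge> 3" "lattice_adj (last v) (hd v)" "E = closing v"
    by (auto simp: pcas_def is_sap_def closing_def)
  have "\<Union>E = set v"
    using v by (auto simp: is_saw_def Union_closing)
  then have "(0, 0) \<in> set v"
    using E by (simp add: pcas_def del: Union_iff)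
  then obtain w where w: "is_saw w" "lattice_adj (last w) (hd w)" "hd w = (0, 0)"
    "closing w = E" "length w \<ge> 3"
    using closing_rotate_to_vertex[OF v(1,3)] v(2,4) by metis
  then obtain y zs where wy: "w = (0, 0) # y # zs" "zs \<noteq> []"
    by (cases w rule: remdups_adj.cases) (auto simp: Suc_le_eq)
  have setw: "set w \<subseteq> square L" "(int L, int L) \<in> set w"
    using E Union_closing[of w] unfolding w(4) by (simp_all add: pcas_def wy(1) del: Union_iff)
  have nbr: "z = (1, 0) \<or> z = (0, 1)" if "lattice_adj (0, 0) z" "z \<in> square L" for z
    using that by (cases z) (auto simp: lattice_adj_def square_def)
  have y: "y = (1, 0) \<or> y = (0, 1)"
    using w(1) wy setw by (intro nbr) (auto simp: is_saw_def)
  have l: "last zs = (1, 0) \<or> last zs = (0, 1)"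
    using w(2) wy setw last_in_set[OF wy(2)] by (intro nbr) (auto simp: lattice_adj_sym)
  have "last zs \<noteq> y"
    using w(1) wy last_in_set[OF wy(2)] by (auto simp: is_saw_def)
  with y l consider "last w = (1, 0)" | "y = (1, 0)" "last zs = (0, 1)"
    using wy by auto
  then show "E \<in> closing ` corner_loops L"
  proof cases
    case 1
    then have "w \<in> corner_loops L"
      using w(1,3) setw by (simp add: corner_loops_def saws_def)
    then show ?thesis
      using w(4) by blast
  next
    case 2
    \<comment> \<open>the same polygon traversed from the origin in the opposite direction\<close>
    let ?w = "(0, 0) # rev zs @ [y]"
    have "closing ?w = closing (rev w)"
      using closing_rotate[of "[(0, 0)]" "rev zs @ [y]"] by (simp add: wy)
    then have "closing ?w = E"
      using w(4) by (simp add: closing_rev)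
    moreover have "is_saw ?w"
      using is_saw_rev[OF w(1)] w(2) wy 2
      by (auto simp: is_saw_def successively_append_iff successively_Cons hd_append hd_rev lattice_adj_def)
    ultimately show ?thesis
      using setw wy 2 by (intro image_eqI[of _ _ ?w]) (auto simp: corner_loops_def saws_def)
  qed
qed

lemma num_pcas_eq_card_corner_loops:
  assumes "L > 0"
  shows "num_pcas L = card (corner_loops L)"
proof -
  have "inj_on closing (corner_loops L)"
  proof (rule inj_onI)
    fix w w' assume ww': "w \<in> corner_loops L" "w' \<in> corner_loops L" "closing w = closing w'"
    then show "w = w'"
      using length_corner_loop[OF _ assms]
      by (intro closing_inject) (auto simp: corner_loops_def saws_def is_saw_def)
  qed
  then show ?thesis
    using closing_image_corner_loops[OF assms] by (metis card_image num_pcas_def)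
qed

section \<open>Comparing polygons with walks\<close>

definition up :: "vertex \<Rightarrow> vertex" where
  "up v = (fst v, snd v + 1)"

text \<open>
  The path from \<open>(1, 0)\<close> along the bottom row and up the right column to \<open>(L + 1, L + 1)\<close>; together
  with the origin it covers the part of the larger square outside the shifted copy of the smaller one.
\<close>
definition rim :: "nat \<Rightarrow> vertex list" where
  "rim L = map (\<lambda>x. (int x, 0)) [1..<L + 2] @ map (\<lambda>y. (int L + 1, int y)) [1..<L + 2]"

lemma up_inj: "inj up"
  and up_adj: "lattice_adj u v \<Longrightarrow> lattice_adj (up u) (up v)"
  by (auto simp: up_def inj_def lattice_adj_def prod_eq_iff)

lemma successively_upt:
  "(\<And>i. m \<le> i \<Longrightarrow> Suc i < n \<Longrightarrow> P i (Suc i)) \<Longrightarrow> successively P [m..<n]"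
proof (induction n)
  case (Suc n)
  show ?case
  proof (cases "m < n")
    case True
    then have "P (n - 1) n"
      using Suc.prems[of "n - 1"] by simp
    then show ?thesis
      using Suc True by (simp add: successively_append_iff)
  qed simp
qed simp

lemma rim_saw:
  "rim L \<in> saws (square (Suc L) - up ` square L - {(0, 0)}) (1, 0) (int (Suc L), int (Suc L))"
proof -
  have "is_saw (rim L)"
    unfolding rim_def
    by (rule is_saw_append)
      (auto simp: is_saw_def distinct_map inj_on_def successively_map lattice_adj_def
        hd_map last_map intro!: successively_upt simp del: upt_Suc)
  then show ?thesis
    by (auto simp: saws_def rim_def square_def up_def hd_map last_map hd_append simp del: upt_Suc)
qed

lemma origin_saw: "[(0, 0)] \<in> saws {(0, 0)} (0, 0) (0, 0)"
  by (simp add: saws_def is_saw_def)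

lemma rim_regions:
  "{(0, 0)} \<union> up ` square L \<union> (square (Suc L) - up ` square L - {(0, 0)}) = square (Suc L)"
  by (auto simp: square_def up_def)

text \<open>
  The common core of both comparisons; they differ only in the direction in which the rim is
  traversed.
\<close>
lemma saws_insert_origin_rim:
  assumes w: "w \<in> saws (square L) (0, 0) v" and s: "s \<in> saws (square (Suc L) - up ` square L - {(0, 0)}) u' v'"
    and adj: "lattice_adj (up v) u'"
  shows "[(0, 0)] @ map up w @ s \<in> saws (square (Suc L)) (0, 0) v'"
proof -
  have "map up w \<in> saws (up ` square L) (0, 1) (up v)"
    using saws_map[OF w up_inj up_adj] up_def[of "(0, 0)"] by simp
  then have "[(0, 0)] @ map up w \<in> saws ({(0, 0)} \<union> up ` square L) (0, 0) (up v)"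
    by (rule saws_append[OF origin_saw]) (auto simp: up_def square_def lattice_adj_def)
  then have "([(0, 0)] @ map up w) @ s \<in> saws ({(0, 0)} \<union> up ` square L \<union> (square (Suc L) - up ` square L - {(0, 0)})) (0, 0) v'"
    using s by (rule saws_append) (use adj in auto)
  then show ?thesis
    unfolding rim_regions by simp
qed

lemma inj_frame: "inj (\<lambda>w. p @ map up w @ s)"
  using up_inj by (auto simp: inj_def)

lemma wcas_eq_saws: "wcas L = saws (square L) (0, 0) (int L, int L)"
  by (simp add: wcas_def saws_def)

text \<open>
  The shifted walk ends at \<open>(L, L + 1)\<close>, next to the far corner, from where the rim leads back to
  \<open>(1, 0)\<close>.
\<close>
lemma num_wcas_le_num_pcas_Suc: "num_wcas L \<le> num_pcas (Suc L)"
proof -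
  have "card (wcas L) \<le> card (corner_loops (Suc L))"
  proof (rule card_inj_on_le)
    show "inj_on (\<lambda>w. [(0, 0)] @ map up w @ rev (rim L)) (wcas L)"
      using inj_frame by (rule inj_on_subset) simp
    show "(\<lambda>w. [(0, 0)] @ map up w @ rev (rim L)) ` wcas L \<subseteq> corner_loops (Suc L)"
    proof (rule image_subsetI)
      fix w assume "w \<in> wcas L"
      then have "[(0, 0)] @ map up w @ rev (rim L) \<in> saws (square (Suc L)) (0, 0) (1, 0)"
        unfolding wcas_eq_saws
        by (rule saws_insert_origin_rim[OF _ saws_rev[OF rim_saw]]) (simp add: up_def lattice_adj_def)
      moreover have "(int (Suc L), int (Suc L)) \<in> set (rim L)"
        by (auto simp: rim_def)
      ultimately show "[(0, 0)] @ map up w @ rev (rim L) \<in> corner_loops (Suc L)"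
        by (simp add: corner_loops_def)
    qed
  qed (rule finite_corner_loops)
  then show ?thesis
    by (simp add: num_pcas_eq_card_corner_loops num_wcas_def)
qed

text \<open>
  The shifted opened polygon ends at \<open>(1, 1)\<close>, just above the start of the rim, which leads to the
  far corner.
\<close>
lemma num_pcas_le_num_wcas_Suc:
  assumes "L > 0"
  shows "num_pcas L \<le> num_wcas (Suc L)"
proof -
  have "card (corner_loops L) \<le> card (wcas (Suc L))"
  proof (rule card_inj_on_le)
    show "inj_on (\<lambda>w. [(0, 0)] @ map up w @ rim L) (corner_loops L)"
      using inj_frame by (rule inj_on_subset) simp
    show "(\<lambda>w. [(0, 0)] @ map up w @ rim L) ` corner_loops L \<subseteq> wcas (Suc L)"
    proof (rule image_subsetI)
      fix w assume "w \<in> corner_loops L"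
      then have "w \<in> saws (square L) (0, 0) (1, 0)"
        by (simp add: corner_loops_def)
      then show "[(0, 0)] @ map up w @ rim L \<in> wcas (Suc L)"
        unfolding wcas_eq_saws
        by (rule saws_insert_origin_rim[OF _ rim_saw]) (simp add: up_def lattice_adj_def)
    qed
  qed (rule finite_wcas)
  then show ?thesis
    using assms by (simp add: num_pcas_eq_card_corner_loops num_wcas_def)
qed

section \<open>Equality of the growth constants\<close>

lemma growth_rate_shift:
  fixes x :: "nat \<Rightarrow> real"
  assumes "(\<lambda>n. x n / real n ^ 2) \<longlonglongrightarrow> l"
  shows "(\<lambda>n. x (n + c) / real n ^ 2) \<longlonglongrightarrow> l"
proof -
  have "(\<lambda>n. x (n + c) / real (n + c) ^ 2 * (1 + real c * inverse (real n)) ^ 2) \<longlonglongrightarrow> l * (1 + real c * 0) ^ 2"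
    using LIMSEQ_ignore_initial_segment[OF assms, of c] by (intro tendsto_intros lim_inverse_n) auto
  moreover have "\<forall>\<^sub>F n in sequentially.
      x (n + c) / real (n + c) ^ 2 * (1 + real c * inverse (real n)) ^ 2 = x (n + c) / real n ^ 2"
    using eventually_gt_at_top[of 0]
  proof eventually_elim
    case (elim n)
    have "1 + real c * inverse (real n) = real (n + c) / real n"
      using elim by (simp add: field_simps)
    then show ?case
      using elim by (simp add: power_divide)
  qed
  ultimately show ?thesis
    by (simp add: tendsto_cong)
qed

lemma growth_seq_tendsto:
  assumes "(\<lambda>L. ln (real (a L)) / real L ^ 2) \<longlonglongrightarrow> l" "\<And>L. L \<ge> 2 \<Longrightarrow> a L > 0"
  shows "growth_seq a \<longlonglongrightarrow> exp l"
proof -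
  have "\<forall>\<^sub>F L in sequentially. exp (ln (real (a L)) / real L ^ 2) = growth_seq a L"
    using eventually_ge_at_top[of 2]
  proof eventually_elim
    case (elim L)
    then show ?case
      using assms(2)[OF elim] by (simp add: growth_seq_def powr_def)
  qed
  with tendsto_exp[OF assms(1)] show ?thesis
    by (simp add: tendsto_cong)
qed

theorem theorem1:
  "convergent (growth_seq num_wcas) \<and>
   convergent (growth_seq num_pcas) \<and>
   growth_constant num_pcas = growth_constant num_wcas"
proof -
  define x where "x n = ln (real (crossings n n))" for n
  obtain l where "(\<lambda>n. x n / real n ^ 2) \<longlonglongrightarrow> l"
    using crossings_growth_converges by (auto simp: convergent_def x_def)
  then have x: "(\<lambda>n. x (n + c) / real n ^ 2) \<longlonglongrightarrow> l" for c
    by (rule growth_rate_shift)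
  have W: "growth_seq num_wcas \<longlonglongrightarrow> exp l"
    using x[of 1] by (intro growth_seq_tendsto) (simp_all add: x_def num_wcas_eq_crossings crossings_square_pos)
  \<comment> \<open>for \<open>L \<ge> 2\<close> both \<open>L - 1\<close> and \<open>L\<close> are positive; \<open>C\<^sub>L\<^sub>-\<^sub>1\<close> and \<open>C\<^sub>L\<^sub>+\<^sub>1\<close> are crossing numbers of \<open>L\<close> and \<open>L + 2\<close> vertices per side\<close>
  have between: "crossings L L \<le> num_pcas L" "num_pcas L \<le> crossings (L + 2) (L + 2)" if "L \<ge> 2" for L
    using that num_wcas_le_num_pcas_Suc[of "L - 1"] num_pcas_le_num_wcas_Suc[of L]
    by (simp_all add: num_wcas_eq_crossings)
  have pos: "num_pcas L > 0" if "L \<ge> 2" for L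
    using between(1)[OF that] crossings_square_pos[of L] that by simp
  have "(\<lambda>L. ln (real (num_pcas L)) / real L ^ 2) \<longlonglongrightarrow> l"
  proof (rule tendsto_sandwich)
    show "\<forall>\<^sub>F L in sequentially. x (L + 0) / real L ^ 2 \<le> ln (real (num_pcas L)) / real L ^ 2"
      using between(1) pos crossings_square_pos
      by (intro eventually_sequentiallyI[of 2] divide_right_mono) (auto simp: x_def)
    show "\<forall>\<^sub>F L in sequentially. ln (real (num_pcas L)) / real L ^ 2 \<le> x (L + 2) / real L ^ 2"
      using between(2) pos crossings_square_pos
      by (intro eventually_sequentiallyI[of 2] divide_right_mono) (auto simp: x_def)
  qed (rule x)+
  then have P: "growth_seq num_pcas \<longlonglongrightarrow> exp l"
    using pos by (rule growth_seq_tendsto)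
  show ?thesis
    using W P limI[OF W] limI[OF P] by (auto simp: growth_constant_def convergent_def)
qed

end
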